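(* Let $T=M\times_\Phi^qS$ be a tight twisted product. If $H$ is an $\mathscr H^M$-class of $M$ and $H'$ is an $\mathscr H^S$-class of $S$, then the following are equivalent: (i) the $\mathscr H^T$-class $H\times H'$ is a group; (ii) $H$ and $H'$ are groups, and $H=H+\Phi(H')q$; (iii) $H$ and $H'$ are groups, and $i\leq_{\mathscr J}^M\Phi(H')q$ for some (equivalently all) $i\in H$; (iv) $H$ and $H'$ are groups, and either $\Phi(H')=0$ or else $i\leq_{\mathscr J}^Mq$ for some (equivalently all) $i\in H$. When these conditions hold, the group $\mathscr H^T$-class $H\times H'$ is isomorphic to the direct product $(H,+)\times(H',\cdot)$.
   Context: $S$ is a monoid (multiplicative, identity $1$); $M$ is a commutative monoid (additive, identity $0$); $q\in M$ is fixed; $\mathbb N=\{0,1,2,\dots\}$. A twisting of $S$ is a map $\Phi:S\times S\to\mathbb N$ with $\Phi(a,b)+\Phi(ab,c)=\Phi(a,bc)+\Phi(b,c)$ for all $a,b,c\in S$. It is tight if (a) for all $a,b\in S$ there is $a'\in S$ with $ab=a'b$ and $\Phi(a',b)=0$; and (b) for all $a,b\in S$ there is $b'\in S$ with $ab=ab'$ and $\Phi(a,b')=0$. The twisted product $M\times_\Phi^qS$ is the semigroup with underlying set $M\times S$ and product $(i,a)(j,b)=(i+j+\Phi(a,b)q,\,ab)$, where for $n\in\mathbb N$, $nq$ is the $n$-fold sum of $q$ in $M$ (and $0q=0$); it is called tight if $\Phi$ is tight (in which case it is a monoid with identity $(0,1)$). Superscripts $M,S,T$ indicate in which monoid Green's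 relations are taken. On a monoid $X$: $a\leq_{\mathscr L}b\iff Xa\subseteq Xb$, $a\leq_{\mathscr R}b\iff aX\subseteq bX$, $a\leq_{\mathscr J}b\iff XaX\subseteq XbX$; $\mathscr L,\mathscr R,\mathscr J$ are the induced equivalences and $\mathscr H=\mathscr L\cap\mathscr R$. In $M$ (commutative) $i\leq_{\mathscr J}^Mj$ means $i=j+l$ for some $l\in M$, and $\mathscr H^M=\mathscr J^M$. The $\mathscr H^T$-classes of $T$ are exactly the sets $H\times H'$ with $H$ an $\mathscr H^M$-class and $H'$ an $\mathscr H^S$-class. An $\mathscr H$-class "is a group" if it is a group under the restriction of the ambient operation (equivalently, it contains an idempotent). For an $\mathscr H^S$-class $H'$, the value $\Phi(a,b)$ is the same for all $a,b\in H'$ (by tightness); this common value is denoted $\Phi(H')$. $H+k=\{h+k:h\in H\}$. *)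

theory Defs
  imports "HOL-Algebra.Coset"
begin

(* All monoids are HOL-Algebra monoids. The commutative monoid M is additive in the mathematical
   source but uses the multiplicative record syntax here: i + j is i \<otimes>\<^bsub>M\<^esub> j, 0 is \<one>\<^bsub>M\<^esub>, the n-fold sum
   nq is q [^]\<^bsub>M\<^esub> n, and H + k is H #>\<^bsub>M\<^esub> k. *)

section \<open>Green's relations\<close>

definition green_le_L :: "('a, 'x) monoid_scheme \<Rightarrow> 'a \<Rightarrow> 'a \<Rightarrow> bool" where
  "green_le_L X a b \<longleftrightarrow> carrier X #>\<^bsub>X\<^esub> a \<subseteq> carrier X #>\<^bsub>X\<^esub> b"

definition green_le_R :: "('a, 'x) monoid_scheme \<Rightarrow> 'a \<Rightarrow> 'a \<Rightarrow> bool" where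
  "green_le_R X a b \<longleftrightarrow> a <#\<^bsub>X\<^esub> carrier X \<subseteq> b <#\<^bsub>X\<^esub> carrier X"

definition green_le_J :: "('a, 'x) monoid_scheme \<Rightarrow> 'a \<Rightarrow> 'a \<Rightarrow> bool" where
  "green_le_J X a b \<longleftrightarrow>
     (carrier X #>\<^bsub>X\<^esub> a) <#>\<^bsub>X\<^esub> carrier X \<subseteq> (carrier X #>\<^bsub>X\<^esub> b) <#>\<^bsub>X\<^esub> carrier X"

definition green_L :: "('a, 'x) monoid_scheme \<Rightarrow> ('a \<times> 'a) set" where
  "green_L X = {(a, b) \<in> carrier X \<times> carrier X. green_le_L X a b \<and> green_le_L X b a}"

definition green_R :: "('a, 'x) monoid_scheme \<Rightarrow> ('a \<times> 'a) set" where
  "green_R X = {(a, b) \<in> carrier X \<times> carrier X. green_le_R X a b \<and> green_le_R X b a}"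

definition green_H :: "('a, 'x) monoid_scheme \<Rightarrow> ('a \<times> 'a) set" where
  "green_H X = green_L X \<inter> green_R X"

definition H_classes :: "('a, 'x) monoid_scheme \<Rightarrow> 'a set set" where
  "H_classes X = carrier X // green_H X"

(* A subset A with the operation of X. Its identity, when there is one, need not be \<one>\<^bsub>X\<^esub>; if A has
   no two-sided identity, the one field is unspecified and the result is not a group. *)
definition restrict_op :: "('a, 'x) monoid_scheme \<Rightarrow> 'a set \<Rightarrow> 'a monoid" where
  "restrict_op X A = \<lparr>carrier = A, mult = mult X,
     one = (THE e. e \<in> A \<and> (\<forall>x\<in>A. e \<otimes>\<^bsub>X\<^esub> x = x \<and> x \<otimes>\<^bsub>X\<^esub> e = x))\<rparr>"


section \<open>Twisted products\<close>

definition twisting :: "('b, 'y) monoid_scheme \<Rightarrow> ('b \<Rightarrow> 'b \<Rightarrow> nat) \<Rightarrow> bool" where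
  "twisting S \<Phi> \<longleftrightarrow> (\<forall>a\<in>carrier S. \<forall>b\<in>carrier S. \<forall>c\<in>carrier S.
     \<Phi> a b + \<Phi> (a \<otimes>\<^bsub>S\<^esub> b) c = \<Phi> a (b \<otimes>\<^bsub>S\<^esub> c) + \<Phi> b c)"

definition tight_twisting :: "('b, 'y) monoid_scheme \<Rightarrow> ('b \<Rightarrow> 'b \<Rightarrow> nat) \<Rightarrow> bool" where
  "tight_twisting S \<Phi> \<longleftrightarrow> twisting S \<Phi> \<and>
     (\<forall>a\<in>carrier S. \<forall>b\<in>carrier S. \<exists>a'\<in>carrier S. a \<otimes>\<^bsub>S\<^esub> b = a' \<otimes>\<^bsub>S\<^esub> b \<and> \<Phi> a' b = 0) \<and>
     (\<forall>a\<in>carrier S. \<forall>b\<in>carrier S. \<exists>b'\<in>carrier S. a \<otimes>\<^bsub>S\<^esub> b = a \<otimes>\<^bsub>S\<^esub> b' \<and> \<Phi> a b' = 0)"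

(* The pair chosen as one is an identity element when \<Phi> is tight: lemma monoid_twisted_product. *)
definition twisted_product :: "('a, 'x) monoid_scheme \<Rightarrow> 'a \<Rightarrow> ('b, 'y) monoid_scheme \<Rightarrow>
    ('b \<Rightarrow> 'b \<Rightarrow> nat) \<Rightarrow> ('a \<times> 'b) monoid" where
  "twisted_product M q S \<Phi> = \<lparr>carrier = carrier M \<times> carrier S,
     mult = (\<lambda>(i, a) (j, b). (i \<otimes>\<^bsub>M\<^esub> j \<otimes>\<^bsub>M\<^esub> (q [^]\<^bsub>M\<^esub> \<Phi> a b), a \<otimes>\<^bsub>S\<^esub> b)),
     one = (\<one>\<^bsub>M\<^esub>, \<one>\<^bsub>S\<^esub>)\<rparr>"

(* The common value \<Phi>(H') of \<Phi> on an H-class H'; lemma class_twist_eq shows that for tight \<Phi> it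
   exists, so that the description is never vacuous there. *)
definition class_twist :: "('b \<Rightarrow> 'b \<Rightarrow> nat) \<Rightarrow> 'b set \<Rightarrow> nat" where
  "class_twist \<Phi> H' = (THE n. \<forall>a\<in>H'. \<forall>b\<in>H'. \<Phi> a b = n)"


section \<open>Well-definedness\<close>

context monoid
begin

lemma green_le_L_iff:
  assumes "a \<in> carrier G" "b \<in> carrier G"
  shows "green_le_L G a b \<longleftrightarrow> (\<exists>x\<in>carrier G. a = x \<otimes> b)"
proof
  assume "green_le_L G a b"
  moreover have "a \<in> carrier G #> a"
    using assms by (auto simp: r_coset_def intro!: bexI[of _ "\<one>"])
  ultimately show "\<exists>x\<in>carrier G. a = x \<otimes> b"
    by (auto simp: green_le_L_def r_coset_def)
next
  assume "\<exists>x\<in>carrier G. a = x \<otimes> b"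
  then obtain x where x: "x \<in> carrier G" "a = x \<otimes> b" by blast
  have "y \<otimes> a \<in> carrier G #> b" if "y \<in> carrier G" for y
    using that x assms m_assoc[of y x b] m_closed[of y x] unfolding r_coset_def by (auto intro!: bexI[of _ "y \<otimes> x"])
  then show "green_le_L G a b"
    unfolding green_le_L_def by (subst r_coset_def) blast
qed

lemma green_le_R_iff:
  assumes "a \<in> carrier G" "b \<in> carrier G"
  shows "green_le_R G a b \<longleftrightarrow> (\<exists>x\<in>carrier G. a = b \<otimes> x)"
proof
  assume "green_le_R G a b"
  moreover have "a \<in> a <# carrier G"
    using assms by (auto simp: l_coset_def intro!: bexI[of _ "\<one>"])
  ultimately show "\<exists>x\<in>carrier G. a = b \<otimes> x"
    by (auto simp: green_le_R_def l_coset_def)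
next
  assume "\<exists>x\<in>carrier G. a = b \<otimes> x"
  then obtain x where x: "x \<in> carrier G" "a = b \<otimes> x" by blast
  have "a \<otimes> y \<in> b <# carrier G" if "y \<in> carrier G" for y
    using that x assms m_assoc[of b x y] m_closed[of x y] unfolding l_coset_def by (auto intro!: bexI[of _ "x \<otimes> y"])
  then show "green_le_R G a b"
    unfolding green_le_R_def by (subst l_coset_def) blast
qed

lemma equiv_green_H: "equiv (carrier G) (green_H G)"
proof (rule equivI)
  show "green_H G \<subseteq> carrier G \<times> carrier G"
    unfolding green_H_def green_L_def by blast
  show "refl_on (carrier G) (green_H G)"
    by (rule refl_onI)
      (simp add: green_H_def green_L_def green_R_def green_le_L_def green_le_R_def)
  show "sym (green_H G)"
    by (rule symI) (simp add: green_H_def green_L_def green_R_def)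
  show "trans (green_H G)"
    unfolding green_H_def green_L_def green_R_def green_le_L_def green_le_R_def
    by (rule transI) (simp, meson subset_trans)
qed

lemma H_classD:
  assumes "A \<in> H_classes G" "a \<in> A" "b \<in> A"
  shows "(a, b) \<in> green_H G"
  using assms quotient_eq_iff[OF equiv_green_H, of A A a b] by (simp add: H_classes_def)

lemma H_class_carrier: "A \<in> H_classes G \<Longrightarrow> A \<subseteq> carrier G"
  using in_quotient_imp_subset[OF equiv_green_H] by (simp add: H_classes_def)

lemma H_class_nonempty: "A \<in> H_classes G \<Longrightarrow> A \<noteq> {}"
  using in_quotient_imp_non_empty[OF equiv_green_H] by (simp add: H_classes_def)

lemma tight_twist_mono_left:
  assumes t: "tight_twisting G \<Phi>"
    and ac: "a \<in> carrier G" "c \<in> carrier G" "b \<in> carrier G" and le: "green_le_L G a c"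
  shows "\<Phi> c b \<le> \<Phi> a b"
proof -
  obtain y where y: "y \<in> carrier G" "a = y \<otimes> c"
    using le green_le_L_iff[of a c] ac by auto
  then obtain x where x: "x \<in> carrier G" "a = x \<otimes> c" "\<Phi> x c = 0"
    using t ac unfolding tight_twisting_def by metis
  have "\<Phi> x c + \<Phi> (x \<otimes> c) b = \<Phi> x (c \<otimes> b) + \<Phi> c b"
    using t x ac unfolding tight_twisting_def twisting_def by blast
  then show ?thesis using x by simp
qed

lemma tight_twist_mono_right:
  assumes t: "tight_twisting G \<Phi>"
    and bd: "a \<in> carrier G" "b \<in> carrier G" "d \<in> carrier G" and le: "green_le_R G b d"
  shows "\<Phi> a d \<le> \<Phi> a b"
proof -
  obtain y where y: "y \<in> carrier G" "b = d \<otimes> y"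
    using le green_le_R_iff[of b d] bd by auto
  then obtain x where x: "x \<in> carrier G" "b = d \<otimes> x" "\<Phi> d x = 0"
    using t bd unfolding tight_twisting_def by metis
  have "\<Phi> a d + \<Phi> (a \<otimes> d) x = \<Phi> a (d \<otimes> x) + \<Phi> d x"
    using t x bd unfolding tight_twisting_def twisting_def by blast
  then show ?thesis using x by simp
qed

lemma class_twist_eq:
  assumes t: "tight_twisting G \<Phi>" and A: "A \<in> H_classes G" and ab: "a \<in> A" "b \<in> A"
  shows "class_twist \<Phi> A = \<Phi> a b"
proof -
  have const: "\<Phi> c d = \<Phi> a b" if cd: "c \<in> A" "d \<in> A" for c d
  proof -
    have car: "a \<in> carrier G" "b \<in> carrier G" "c \<in> carrier G" "d \<in> carrier G"
      using H_class_carrier[OF A] ab cd by auto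
    have "(a, c) \<in> green_L G" "(b, d) \<in> green_R G"
      using H_classD[OF A ab(1) cd(1)] H_classD[OF A ab(2) cd(2)] by (auto simp: green_H_def)
    then have "\<Phi> c d = \<Phi> a d" "\<Phi> a d = \<Phi> a b"
      using tight_twist_mono_left[OF t] tight_twist_mono_right[OF t] car
      by (auto simp: green_L_def green_R_def intro!: antisym)
    then show ?thesis by simp
  qed
  show ?thesis
    unfolding class_twist_def proof (rule the_equality)
    show "\<forall>c\<in>A. \<forall>d\<in>A. \<Phi> c d = \<Phi> a b" using const by blast
    show "n = \<Phi> a b" if "\<forall>c\<in>A. \<forall>d\<in>A. \<Phi> c d = n" for n using that ab by metis
  qed
qed

end

lemma tight_twist_one:
  assumes S: "monoid S" and t: "tight_twisting S \<Phi>" and a: "a \<in> carrier S"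
  shows "\<Phi> \<one>\<^bsub>S\<^esub> a = 0" "\<Phi> a \<one>\<^bsub>S\<^esub> = 0"
proof -
  interpret S: monoid S by fact
  obtain e where "e \<in> carrier S" "\<one>\<^bsub>S\<^esub> \<otimes>\<^bsub>S\<^esub> \<one>\<^bsub>S\<^esub> = e \<otimes>\<^bsub>S\<^esub> \<one>\<^bsub>S\<^esub>" "\<Phi> e \<one>\<^bsub>S\<^esub> = 0"
    using t S.one_closed unfolding tight_twisting_def by meson
  then have z: "\<Phi> \<one>\<^bsub>S\<^esub> \<one>\<^bsub>S\<^esub> = 0" by simp
  have "\<Phi> \<one>\<^bsub>S\<^esub> \<one>\<^bsub>S\<^esub> + \<Phi> (\<one>\<^bsub>S\<^esub> \<otimes>\<^bsub>S\<^esub> \<one>\<^bsub>S\<^esub>) a = \<Phi> \<one>\<^bsub>S\<^esub> (\<one>\<^bsub>S\<^esub> \<otimes>\<^bsub>S\<^esub> a) + \<Phi> \<one>\<^bsub>S\<^esub> a"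
    "\<Phi> a \<one>\<^bsub>S\<^esub> + \<Phi> (a \<otimes>\<^bsub>S\<^esub> \<one>\<^bsub>S\<^esub>) \<one>\<^bsub>S\<^esub> = \<Phi> a (\<one>\<^bsub>S\<^esub> \<otimes>\<^bsub>S\<^esub> \<one>\<^bsub>S\<^esub>) + \<Phi> \<one>\<^bsub>S\<^esub> \<one>\<^bsub>S\<^esub>"
    using t a S.one_closed unfolding tight_twisting_def twisting_def by blast+
  with z a show "\<Phi> \<one>\<^bsub>S\<^esub> a = 0" "\<Phi> a \<one>\<^bsub>S\<^esub> = 0" by auto
qed

lemma monoid_twisted_product:
  assumes M: "comm_monoid M" and S: "monoid S" and q: "q \<in> carrier M"
    and t: "tight_twisting S \<Phi>"
  shows "monoid (twisted_product M q S \<Phi>)"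
proof -
  interpret M: comm_monoid M by fact
  interpret S: monoid S by fact
  have assoc: "i \<otimes>\<^bsub>M\<^esub> j \<otimes>\<^bsub>M\<^esub> q [^]\<^bsub>M\<^esub> \<Phi> a b \<otimes>\<^bsub>M\<^esub> k \<otimes>\<^bsub>M\<^esub> q [^]\<^bsub>M\<^esub> \<Phi> (a \<otimes>\<^bsub>S\<^esub> b) c =
      i \<otimes>\<^bsub>M\<^esub> (j \<otimes>\<^bsub>M\<^esub> k \<otimes>\<^bsub>M\<^esub> q [^]\<^bsub>M\<^esub> \<Phi> b c) \<otimes>\<^bsub>M\<^esub> q [^]\<^bsub>M\<^esub> \<Phi> a (b \<otimes>\<^bsub>S\<^esub> c)"
    if car: "i \<in> carrier M" "j \<in> carrier M" "k \<in> carrier M"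
      "a \<in> carrier S" "b \<in> carrier S" "c \<in> carrier S" for i j k a b c
  proof -
    have "\<Phi> a b + \<Phi> (a \<otimes>\<^bsub>S\<^esub> b) c = \<Phi> b c + \<Phi> a (b \<otimes>\<^bsub>S\<^esub> c)"
      using t car unfolding tight_twisting_def twisting_def by simp
    then have "q [^]\<^bsub>M\<^esub> \<Phi> a b \<otimes>\<^bsub>M\<^esub> q [^]\<^bsub>M\<^esub> \<Phi> (a \<otimes>\<^bsub>S\<^esub> b) c =
        q [^]\<^bsub>M\<^esub> \<Phi> b c \<otimes>\<^bsub>M\<^esub> q [^]\<^bsub>M\<^esub> \<Phi> a (b \<otimes>\<^bsub>S\<^esub> c)"
      using q by (simp add: M.nat_pow_mult)
    then have e: "i \<otimes>\<^bsub>M\<^esub> j \<otimes>\<^bsub>M\<^esub> k \<otimes>\<^bsub>M\<^esub> (q [^]\<^bsub>M\<^esub> \<Phi> a b \<otimes>\<^bsub>M\<^esub> q [^]\<^bsub>M\<^esub> \<Phi> (a \<otimes>\<^bsub>S\<^esub> b) c) =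
        i \<otimes>\<^bsub>M\<^esub> j \<otimes>\<^bsub>M\<^esub> k \<otimes>\<^bsub>M\<^esub> (q [^]\<^bsub>M\<^esub> \<Phi> b c \<otimes>\<^bsub>M\<^esub> q [^]\<^bsub>M\<^esub> \<Phi> a (b \<otimes>\<^bsub>S\<^esub> c))"
      by simp
    have l: "i \<otimes>\<^bsub>M\<^esub> j \<otimes>\<^bsub>M\<^esub> u \<otimes>\<^bsub>M\<^esub> k \<otimes>\<^bsub>M\<^esub> v = i \<otimes>\<^bsub>M\<^esub> j \<otimes>\<^bsub>M\<^esub> k \<otimes>\<^bsub>M\<^esub> (u \<otimes>\<^bsub>M\<^esub> v)"
      "i \<otimes>\<^bsub>M\<^esub> (j \<otimes>\<^bsub>M\<^esub> k \<otimes>\<^bsub>M\<^esub> u) \<otimes>\<^bsub>M\<^esub> v = i \<otimes>\<^bsub>M\<^esub> j \<otimes>\<^bsub>M\<^esub> k \<otimes>\<^bsub>M\<^esub> (u \<otimes>\<^bsub>M\<^esub> v)"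
      if "u \<in> carrier M" "v \<in> carrier M" for u v
      using car that by (simp_all add: M.m_ac)
    show ?thesis
      using e car q by (simp only: l M.nat_pow_closed)
  qed
  show ?thesis
    using q assoc
    by unfold_locales
      (auto simp: twisted_product_def S.m_assoc tight_twist_one[OF S t])
qed

end

(* An H-class of a monoid is a group as soon as it contains an idempotent, so (i) asks for an
   idempotent of H \<times> H'. A pair (e, f) is idempotent when f is idempotent and 2e + nq = e, with
   n = \<Phi>(H'); then e + nq is an idempotent of H. Conversely, if e is an idempotent of H with
   e = l + nq, then (e + l, f) is idempotent. Translation by nq in the first coordinate is the
   isomorphism. *)
theory Submission
  imports Defs
begin

section \<open>Green's H in a monoid and the idempotent criterion for group H-classes\<close>

context monoid
begin

lemma green_H_iff:
  "(a, b) \<in> green_H G \<longleftrightarrow> a \<in> carrier G \<and> b \<in> carrier G \<and>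
     (\<exists>x\<in>carrier G. a = x \<otimes> b) \<and> (\<exists>x\<in>carrier G. b = x \<otimes> a) \<and>
     (\<exists>x\<in>carrier G. a = b \<otimes> x) \<and> (\<exists>x\<in>carrier G. b = a \<otimes> x)"
  by (cases "a \<in> carrier G \<and> b \<in> carrier G")
    (simp_all add: green_H_def green_L_def green_R_def green_le_L_iff green_le_R_iff,
      blast)

lemma H_class_mem_iff:
  assumes "A \<in> H_classes G" "a \<in> A"
  shows "b \<in> A \<longleftrightarrow> (a, b) \<in> green_H G"
  using assms H_classD in_quotient_imp_closed[OF equiv_green_H, of A a b]
  by (auto simp: H_classes_def)

lemma H_class_of: "a \<in> carrier G \<Longrightarrow> green_H G `` {a} \<in> H_classes G"
  by (simp add: H_classes_def quotientI)

text \<open>Every element of \<open>A\<close> is a left and a right multiple of \<open>e\<close>,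
  and the idempotent \<open>e\<close> fixes such multiples, so it is an identity on
  \<open>A\<close>. Closure and inverses come from the cofactors that express \<open>e\<close> as a
  multiple of each element.\<close>

lemma group_restrict_opI:
  assumes A: "A \<in> H_classes G" and e: "e \<in> A" "e \<otimes> e = e"
  shows "group (restrict_op G A)"
proof -
  have car: "x \<in> carrier G" if "x \<in> A" for x
    using H_class_carrier[OF A] that by blast
  note ecar = car[OF e(1)]
  have mem: "x \<in> A \<longleftrightarrow> (e, x) \<in> green_H G" for x
    using H_class_mem_iff[OF A e(1)] .
  have ex: "\<exists>u\<in>carrier G. x = u \<otimes> e" "\<exists>u\<in>carrier G. e = u \<otimes> x"
    "\<exists>u\<in>carrier G. x = e \<otimes> u" "\<exists>u\<in>carrier G. e = x \<otimes> u" if "x \<in> A" for x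
    using that by (simp_all add: mem green_H_iff)
  have le: "e \<otimes> x = x" and re: "x \<otimes> e = x" if "x \<in> A" for x
  proof -
    obtain u where "u \<in> carrier G" "x = e \<otimes> u" using ex(3)[OF \<open>x \<in> A\<close>] by blast
    moreover obtain v where "v \<in> carrier G" "x = v \<otimes> e" using ex(1)[OF \<open>x \<in> A\<close>] by blast
    ultimately show "e \<otimes> x = x" "x \<otimes> e = x"
      using ecar e(2) m_assoc[of e e u] m_assoc[of v e e] by auto
  qed
  have closed: "x \<otimes> y \<in> A" if xy: "x \<in> A" "y \<in> A" for x y
  proof -
    obtain u where u: "u \<in> carrier G" "e = x \<otimes> u" using ex(4)[OF xy(1)] by blast
    obtain u' where u': "u' \<in> carrier G" "e = u' \<otimes> x" using ex(2)[OF xy(1)] by blast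
    obtain v where v: "v \<in> carrier G" "e = y \<otimes> v" using ex(4)[OF xy(2)] by blast
    obtain v' where v': "v' \<in> carrier G" "e = v' \<otimes> y" using ex(2)[OF xy(2)] by blast
    note c = car[OF xy(1)] car[OF xy(2)] ecar
    \<comment> \<open>The cofactors compose in reverse order: the inner \<open>y \<otimes> v\<close>
      collapses to \<open>e\<close>, which \<open>x\<close> absorbs, and
      \<open>x \<otimes> u = e\<close> remains. The left side is dual.\<close>
    have "x \<otimes> y \<otimes> (v \<otimes> u) = x \<otimes> (y \<otimes> v) \<otimes> u"
      using c u(1) v(1) by (simp add: m_assoc)
    then have 1: "e = x \<otimes> y \<otimes> (v \<otimes> u)"
      using re[OF xy(1)] u(2) v(2) by simp
    have "v' \<otimes> u' \<otimes> (x \<otimes> y) = v' \<otimes> (u' \<otimes> x \<otimes> y)"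
      using c u'(1) v'(1) by (simp add: m_assoc)
    then have 2: "e = v' \<otimes> u' \<otimes> (x \<otimes> y)"
      using le[OF xy(2)] u'(2) v'(2) by simp
    have 3: "x \<otimes> y = e \<otimes> (x \<otimes> y)" "x \<otimes> y = x \<otimes> y \<otimes> e"
      using c le[OF xy(1)] re[OF xy(2)] m_assoc[of e x y] m_assoc[of x y e] by auto
    show ?thesis
      unfolding mem green_H_iff
      using 1 2 3 c u(1) v(1) u'(1) v'(1) m_closed by blast
  qed
  have inv: "\<exists>y\<in>A. y \<otimes> x = e" if x: "x \<in> A" for x
  proof -
    obtain u where u: "u \<in> carrier G" "e = x \<otimes> u" using ex(4)[OF x] by blast
    obtain w where w: "w \<in> carrier G" "e = w \<otimes> x" using ex(2)[OF x] by blast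
    note c = car[OF x] ecar
    \<comment> \<open>The cofactor \<open>u\<close> may lie outside \<open>A\<close>; multiplying it
      by \<open>e\<close> corrects this. Since \<open>e = w \<otimes> x\<close>, the same element
      equals \<open>w \<otimes> e\<close>, so it is fixed by \<open>e\<close> on both sides and
      inverts \<open>x\<close> on both sides.\<close>
    define y where "y = e \<otimes> u"
    have y: "y \<in> carrier G" using c u(1) by (simp add: y_def)
    have xy: "x \<otimes> y = e"
      using c u re[OF x] m_assoc[of x e u] by (simp add: y_def)
    have "y = w \<otimes> x \<otimes> u" using w by (simp add: y_def)
    also have "\<dots> = w \<otimes> e" using c u w(1) by (simp add: m_assoc)
    finally have yw: "y = w \<otimes> e" .
    have yx: "y \<otimes> x = e"
      unfolding yw using c w(1) le[OF x] w(2) m_assoc[of w e x] by simp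
    have "y = e \<otimes> y" using c u(1) e(2) m_assoc[of e e u] by (simp add: y_def)
    moreover have "y = y \<otimes> e" unfolding yw using c w(1) e(2) m_assoc[of w e e] by simp
    ultimately have "(e, y) \<in> green_H G"
      unfolding green_H_iff using xy yx y c by metis
    with yx show ?thesis using mem by blast
  qed
  \<comment> \<open>The \<open>one\<close> field of \<open>restrict_op\<close> is a definite
    description and has to be evaluated before the group axioms can be checked.\<close>
  have one: "(THE z. z \<in> A \<and> (\<forall>x\<in>A. z \<otimes> x = x \<and> x \<otimes> z = x)) = e"
    by (rule the_equality) (use e(1) le re in force)+
  show ?thesis
    by (rule groupI) (auto simp: restrict_op_def one closed e(1) le inv m_assoc car)
qed

text \<open>The new direction is from left to right: the identity of the group lies in
  \<open>A\<close> and is idempotent in \<open>G\<close>, since \<open>restrict_op\<close> keeps the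
  multiplication.\<close>

lemma group_restrict_op_iff:
  assumes A: "A \<in> H_classes G"
  shows "group (restrict_op G A) \<longleftrightarrow> (\<exists>e\<in>A. e \<otimes> e = e)"
proof
  assume "group (restrict_op G A)"
  then interpret A: group "restrict_op G A" .
  have "\<one>\<^bsub>restrict_op G A\<^esub> \<in> A" "\<one>\<^bsub>restrict_op G A\<^esub> \<otimes> \<one>\<^bsub>restrict_op G A\<^esub> = \<one>\<^bsub>restrict_op G A\<^esub>"
    using A.one_closed A.l_one[OF A.one_closed] by (simp_all add: restrict_op_def)
  then show "\<exists>e\<in>A. e \<otimes> e = e" by blast
qed (use group_restrict_opI[OF A] in blast)

end

section \<open>Commutative monoids: divisibility, idempotents and translates of H-classes\<close>

context comm_monoid
begin

text \<open>Commutativity moves right factors to the left, so principal two-sided ideals are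
  principal left ideals.\<close>

lemma green_le_J_iff:
  assumes "a \<in> carrier G" "b \<in> carrier G"
  shows "green_le_J G a b \<longleftrightarrow> (\<exists>x\<in>carrier G. a = x \<otimes> b)"
proof -
  have "carrier G #> c <#> carrier G = carrier G #> c" if c: "c \<in> carrier G" for c
  proof (intro equalityI subsetI)
    fix z assume "z \<in> carrier G #> c <#> carrier G"
    then obtain x y where "x \<in> carrier G" "y \<in> carrier G" "z = x \<otimes> c \<otimes> y"
      by (auto simp: r_coset_def set_mult_def)
    then have "x \<otimes> y \<in> carrier G" "z = x \<otimes> y \<otimes> c" using c by (auto simp: m_ac)
    then show "z \<in> carrier G #> c" by (auto simp: r_coset_def)
  next
    fix z assume "z \<in> carrier G #> c"
    then obtain x where "x \<in> carrier G" "z = x \<otimes> c" by (auto simp: r_coset_def)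
    then have "z = x \<otimes> c \<otimes> \<one>" "x \<otimes> c \<in> carrier G #> c" using c by (auto simp: r_coset_def)
    then show "z \<in> carrier G #> c <#> carrier G" by (auto simp: set_mult_def)
  qed
  then have "green_le_J G a b \<longleftrightarrow> green_le_L G a b"
    using assms by (simp add: green_le_J_def green_le_L_def)
  then show ?thesis using green_le_L_iff assms by simp
qed

lemma green_H_iff_J:
  "(a, b) \<in> green_H G \<longleftrightarrow>
     a \<in> carrier G \<and> b \<in> carrier G \<and> green_le_J G a b \<and> green_le_J G b a"
proof (cases "a \<in> carrier G \<and> b \<in> carrier G")
  case True
  then have "(\<exists>x\<in>carrier G. a = b \<otimes> x) \<longleftrightarrow> (\<exists>x\<in>carrier G. a = x \<otimes> b)"
    "(\<exists>x\<in>carrier G. b = a \<otimes> x) \<longleftrightarrow> (\<exists>x\<in>carrier G. b = x \<otimes> a)"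
    by (auto simp: m_comm)
  with True show ?thesis by (auto simp: green_H_iff green_le_J_iff)
qed (auto simp: green_H_iff)

text \<open>Members of one class generate the same principal ideal, and the order sees an element
  only through that ideal. This justifies each "some (equivalently all)".\<close>

lemma H_class_ex_J_iff_all:
  assumes A: "A \<in> H_classes G"
  shows "(\<exists>i\<in>A. green_le_J G i k) \<longleftrightarrow> (\<forall>i\<in>A. green_le_J G i k)"
proof
  assume "\<exists>i\<in>A. green_le_J G i k"
  then show "\<forall>i\<in>A. green_le_J G i k"
    using H_classD[OF A] unfolding green_H_iff_J green_le_J_def by blast
qed (use H_class_nonempty[OF A] in blast)

text \<open>The equation makes \<open>h\<close> a multiple of \<open>h \<otimes> k\<close>; the
  converse divisibility is automatic. This is the tool for keeping translates inside their
  class.\<close>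

lemma H_class_mult_mem:
  assumes A: "A \<in> H_classes G" and h: "h \<in> A" and k: "k \<in> carrier G" "l \<in> carrier G"
    and eq: "h = h \<otimes> k \<otimes> l"
  shows "h \<otimes> k \<in> A"
proof -
  have hc: "h \<in> carrier G" using H_class_carrier[OF A] h by blast
  have "h = l \<otimes> (h \<otimes> k)" "h \<otimes> k = k \<otimes> h" using eq hc k by (auto simp: m_comm)
  then have "(h, h \<otimes> k) \<in> green_H G"
    using hc k by (auto simp: green_H_iff_J green_le_J_iff)
  then show ?thesis using H_class_mem_iff[OF A h] by blast
qed

lemma H_class_group_identity:
  assumes A: "A \<in> H_classes G" and e: "e \<in> A" "e \<otimes> e = e" and h: "h \<in> A"
  shows "h \<otimes> e = h"
proof -
  have "e \<in> carrier G" using H_class_carrier[OF A] e by blast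
  moreover obtain u where "u \<in> carrier G" "h = u \<otimes> e"
    using H_classD[OF A h e(1)] unfolding green_H_iff by blast
  ultimately show ?thesis using e by (simp add: m_assoc)
qed

text \<open>An idempotent can be raised to powers: \<open>e = x \<otimes> q\<close> gives
  \<open>e = e \<otimes> x [^] n \<otimes> q [^] n\<close>. Conversely, a positive power of
  \<open>q\<close> contains a factor \<open>q\<close>.\<close>

lemma H_class_idem_le_pow_iff:
  assumes A: "A \<in> H_classes G" and e: "e \<in> A" "e \<otimes> e = e" and q: "q \<in> carrier G"
  shows "(\<exists>i\<in>A. green_le_J G i (q [^] (n::nat))) \<longleftrightarrow> n = 0 \<or> (\<exists>i\<in>A. green_le_J G i q)"
proof -
  have ec: "e \<in> carrier G" using H_class_carrier[OF A] e by blast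
  \<comment> \<open>Both conditions can be tested at \<open>e\<close> alone, where idempotency is
    available.\<close>
  have ex: "(\<exists>i\<in>A. green_le_J G i k) \<longleftrightarrow> (\<exists>x\<in>carrier G. e = x \<otimes> k)"
    if "k \<in> carrier G" for k
    using H_class_ex_J_iff_all[OF A, of k] e(1) green_le_J_iff[OF ec that] by blast
  have "(\<exists>x\<in>carrier G. e = x \<otimes> q [^] n) \<longleftrightarrow> n = 0 \<or> (\<exists>x\<in>carrier G. e = x \<otimes> q)"
  proof (intro iffI)
    assume "\<exists>x\<in>carrier G. e = x \<otimes> q [^] n"
    then obtain x where x: "x \<in> carrier G" "e = x \<otimes> q [^] n" by blast
    show "n = 0 \<or> (\<exists>x\<in>carrier G. e = x \<otimes> q)"
    proof (cases n)
      case (Suc m)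
      then have "e = x \<otimes> q [^] m \<otimes> q" "x \<otimes> q [^] m \<in> carrier G"
        using x q by (simp_all add: m_assoc)
      then show ?thesis by blast
    qed simp
  next
    assume "n = 0 \<or> (\<exists>x\<in>carrier G. e = x \<otimes> q)"
    then show "\<exists>x\<in>carrier G. e = x \<otimes> q [^] n"
    proof
      assume "\<exists>x\<in>carrier G. e = x \<otimes> q"
      then obtain x where x: "x \<in> carrier G" "e = x \<otimes> q" by blast
      \<comment> \<open>Exponents start at one because \<open>e [^] 0\<close> is the identity of
        \<open>G\<close>, which may differ from \<open>e\<close>. The extra factor \<open>e\<close>
        below lets the computation cover \<open>n = 0\<close> as well.\<close>
      have pow: "e [^] Suc m = e" for m
        using e(2) ec by (induction m) simp_all
      have "e = e \<otimes> e [^] n" using pow[of n] ec nat_pow_Suc2[OF ec, of n] by simp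
      also have "\<dots> = e \<otimes> x [^] n \<otimes> q [^] n"
        using x q ec by (simp add: nat_pow_distrib m_assoc)
      finally show ?thesis using x q ec by blast
    qed (use ec in auto)
  qed
  then show ?thesis using ex q by simp
qed

text \<open>If \<open>e = l \<otimes> k\<close>, then multiplication by \<open>l\<close> inverts
  multiplication by \<open>k\<close> on \<open>A\<close>, because \<open>e\<close> acts there as an
  identity. Conversely, \<open>e\<close> lying in the translate is a multiple of
  \<open>k\<close>.\<close>

lemma H_class_idem_eq_translate_iff:
  assumes A: "A \<in> H_classes G" and e: "e \<in> A" "e \<otimes> e = e" and k: "k \<in> carrier G"
  shows "A = A #> k \<longleftrightarrow> (\<exists>i\<in>A. green_le_J G i k)"
proof
  assume "A = A #> k"
  with e(1) obtain h where "h \<in> A" "e = h \<otimes> k" by (auto simp: r_coset_def)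
  then have "green_le_J G e k"
    using green_le_J_iff[of e k] H_class_carrier[OF A] e(1) k by blast
  with e(1) show "\<exists>i\<in>A. green_le_J G i k" by blast
next
  assume "\<exists>i\<in>A. green_le_J G i k"
  then obtain l where l: "l \<in> carrier G" "e = l \<otimes> k"
    using H_class_ex_J_iff_all[OF A] green_le_J_iff[of e k] H_class_carrier[OF A] e(1) k by blast
  have hl: "h \<otimes> l \<otimes> k = h" "h \<otimes> k \<otimes> l = h" if h: "h \<in> A" for h
    using H_class_group_identity[OF A e h] l k H_class_carrier[OF A] h by (auto simp: m_ac)
  show "A = A #> k"
  proof (intro equalityI subsetI)
    fix h assume h: "h \<in> A"
    then have "h \<otimes> l \<in> A" using H_class_mult_mem[OF A h l(1) k] hl by simp
    then show "h \<in> A #> k" using hl(1)[OF h] unfolding r_coset_def by force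
  next
    fix h assume "h \<in> A #> k"
    then show "h \<in> A"
      using H_class_mult_mem[OF A _ k l(1)] hl by (auto simp: r_coset_def)
  qed
qed

end

section \<open>Green's H and group H-classes in a tight twisted product\<close>

locale tight_product = M: comm_monoid M + S: monoid S
  for M :: "('a, 'x) monoid_scheme" (structure) and S :: "('b, 'y) monoid_scheme" (structure) +
  fixes q :: 'a and \<Phi> :: "'b \<Rightarrow> 'b \<Rightarrow> nat"
  assumes q: "q \<in> carrier M" and tight: "tight_twisting S \<Phi>"
begin

abbreviation "T \<equiv> twisted_product M q S \<Phi>"

sublocale T: monoid T
  using monoid_twisted_product[OF M.comm_monoid_axioms S.monoid_axioms q tight] .

lemma carrier_T: "carrier T = carrier M \<times> carrier S"
  by (simp add: twisted_product_def)

lemma mult_T: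
  "(i, a) \<otimes>\<^bsub>T\<^esub> (j, b) = (i \<otimes>\<^bsub>M\<^esub> j \<otimes>\<^bsub>M\<^esub> q [^]\<^bsub>M\<^esub> \<Phi> a b, a \<otimes>\<^bsub>S\<^esub> b)"
  by (simp add: twisted_product_def)

text \<open>By tightness the cofactor in \<open>S\<close> can be chosen so that no twist arises.\<close>

lemma left_multiple_T_iff:
  assumes "i \<in> carrier M" "j \<in> carrier M" "a \<in> carrier S" "b \<in> carrier S"
  shows "(\<exists>x\<in>carrier T. (i, a) = x \<otimes>\<^bsub>T\<^esub> (j, b)) \<longleftrightarrow>
    green_le_J M i j \<and> (\<exists>c\<in>carrier S. a = c \<otimes>\<^bsub>S\<^esub> b)"
proof (intro iffI conjI; (elim conjE)?)
  assume "\<exists>x\<in>carrier T. (i, a) = x \<otimes>\<^bsub>T\<^esub> (j, b)"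
  then obtain k c where k: "k \<in> carrier M" "c \<in> carrier S"
    "i = k \<otimes>\<^bsub>M\<^esub> j \<otimes>\<^bsub>M\<^esub> q [^]\<^bsub>M\<^esub> \<Phi> c b" "a = c \<otimes>\<^bsub>S\<^esub> b"
    by (auto simp: carrier_T mult_T)
  \<comment> \<open>The twist is absorbed into the cofactor in \<open>M\<close>.\<close>
  then have "i = k \<otimes>\<^bsub>M\<^esub> q [^]\<^bsub>M\<^esub> \<Phi> c b \<otimes>\<^bsub>M\<^esub> j"
    using assms q by (simp add: M.m_ac)
  moreover have "k \<otimes>\<^bsub>M\<^esub> q [^]\<^bsub>M\<^esub> \<Phi> c b \<in> carrier M" using k q by simp
  ultimately show "green_le_J M i j" using M.green_le_J_iff assms by blast
  show "\<exists>c\<in>carrier S. a = c \<otimes>\<^bsub>S\<^esub> b" using k by blast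
next
  assume "green_le_J M i j" "\<exists>c\<in>carrier S. a = c \<otimes>\<^bsub>S\<^esub> b"
  then obtain k c where "k \<in> carrier M" "i = k \<otimes>\<^bsub>M\<^esub> j"
    "c \<in> carrier S" "a = c \<otimes>\<^bsub>S\<^esub> b" "\<Phi> c b = 0"
    using M.green_le_J_iff assms tight unfolding tight_twisting_def by metis
  then show "\<exists>x\<in>carrier T. (i, a) = x \<otimes>\<^bsub>T\<^esub> (j, b)"
    using assms by (intro bexI[of _ "(k, c)"]) (auto simp: carrier_T mult_T)
qed

text \<open>Dual to left multiples, now with the second tightness condition. Commutativity of
  \<open>M\<close> lets \<open>green_le_J M\<close> serve on both sides.\<close>

lemma right_multiple_T_iff:
  assumes "i \<in> carrier M" "j \<in> carrier M" "a \<in> carrier S" "b \<in> carrier S"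
  shows "(\<exists>x\<in>carrier T. (i, a) = (j, b) \<otimes>\<^bsub>T\<^esub> x) \<longleftrightarrow>
    green_le_J M i j \<and> (\<exists>c\<in>carrier S. a = b \<otimes>\<^bsub>S\<^esub> c)"
proof (intro iffI conjI; (elim conjE)?)
  assume "\<exists>x\<in>carrier T. (i, a) = (j, b) \<otimes>\<^bsub>T\<^esub> x"
  then obtain k c where k: "k \<in> carrier M" "c \<in> carrier S"
    "i = j \<otimes>\<^bsub>M\<^esub> k \<otimes>\<^bsub>M\<^esub> q [^]\<^bsub>M\<^esub> \<Phi> b c" "a = b \<otimes>\<^bsub>S\<^esub> c"
    by (auto simp: carrier_T mult_T)
  then have "i = k \<otimes>\<^bsub>M\<^esub> q [^]\<^bsub>M\<^esub> \<Phi> b c \<otimes>\<^bsub>M\<^esub> j"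
    using assms q by (simp add: M.m_ac)
  moreover have "k \<otimes>\<^bsub>M\<^esub> q [^]\<^bsub>M\<^esub> \<Phi> b c \<in> carrier M" using k q by simp
  ultimately show "green_le_J M i j" using M.green_le_J_iff assms by blast
  show "\<exists>c\<in>carrier S. a = b \<otimes>\<^bsub>S\<^esub> c" using k by blast
next
  assume "green_le_J M i j" "\<exists>c\<in>carrier S. a = b \<otimes>\<^bsub>S\<^esub> c"
  then obtain k c where "k \<in> carrier M" "i = k \<otimes>\<^bsub>M\<^esub> j"
    "c \<in> carrier S" "a = b \<otimes>\<^bsub>S\<^esub> c" "\<Phi> b c = 0"
    using M.green_le_J_iff assms tight unfolding tight_twisting_def by metis
  then show "\<exists>x\<in>carrier T. (i, a) = (j, b) \<otimes>\<^bsub>T\<^esub> x"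
    using assms by (intro bexI[of _ "(k, c)"]) (auto simp: carrier_T mult_T M.m_comm)
qed

text \<open>Divisibility in \<open>T\<close> splits into coordinates on either side and leaves no
  trace of the twist. The coordinate in \<open>M\<close> is governed by J, which is H for
  commutative \<open>M\<close>.\<close>

lemma green_H_T_iff:
  "((i, a), (j, b)) \<in> green_H T \<longleftrightarrow> (i, j) \<in> green_H M \<and> (a, b) \<in> green_H S"
proof (cases "i \<in> carrier M \<and> j \<in> carrier M \<and> a \<in> carrier S \<and> b \<in> carrier S")
  case True
  then have car: "i \<in> carrier M" "j \<in> carrier M" "a \<in> carrier S" "b \<in> carrier S" by auto
  note ij = left_multiple_T_iff[OF car] right_multiple_T_iff[OF car]
  note ji = left_multiple_T_iff[OF car(2,1,4,3)] right_multiple_T_iff[OF car(2,1,4,3)]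
  from car have "(i, a) \<in> carrier T" "(j, b) \<in> carrier T" by (simp_all add: carrier_T)
  with car show ?thesis
    unfolding T.green_H_iff S.green_H_iff M.green_H_iff_J ij ji by blast
qed (auto simp: T.green_H_iff S.green_H_iff M.green_H_iff carrier_T)

text \<open>Since H is coordinatewise, the class of a pair is the product of the classes. The
  idempotent criterion thereby applies to \<open>H \<times> H'\<close> in \<open>T\<close>.\<close>

lemma H_class_Times:
  assumes H: "H \<in> H_classes M" and H': "H' \<in> H_classes S"
  shows "H \<times> H' \<in> H_classes T"
proof -
  obtain i a where ia: "i \<in> H" "a \<in> H'"
    using M.H_class_nonempty[OF H] S.H_class_nonempty[OF H'] by blast
  have "H \<times> H' = green_H T `` {(i, a)}"
    using M.H_class_mem_iff[OF H ia(1)] S.H_class_mem_iff[OF H' ia(2)]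
    by (auto simp: green_H_T_iff)
  moreover have "(i, a) \<in> carrier T"
    using ia M.H_class_carrier[OF H] S.H_class_carrier[OF H'] by (auto simp: carrier_T)
  ultimately show ?thesis using T.H_class_of by simp
qed

lemma group_Times_iff:
  assumes H: "H \<in> H_classes M" and H': "H' \<in> H_classes S"
  shows "group (restrict_op T (H \<times> H')) \<longleftrightarrow>
    group (restrict_op M H) \<and> group (restrict_op S H') \<and>
    (\<exists>i\<in>H. green_le_J M i (q [^]\<^bsub>M\<^esub> class_twist \<Phi> H'))" (is "?L \<longleftrightarrow> ?R")
proof -
  define k where "k = q [^]\<^bsub>M\<^esub> class_twist \<Phi> H'"
  have k: "k \<in> carrier M" using q by (simp add: k_def)
  \<comment> \<open>On a single H-class of \<open>S\<close> the twist is constant, so each product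
    in \<open>H \<times> H'\<close> picks up the same element \<open>k\<close>.\<close>
  have mult: "(i, a) \<otimes>\<^bsub>T\<^esub> (j, b) = (i \<otimes>\<^bsub>M\<^esub> j \<otimes>\<^bsub>M\<^esub> k, a \<otimes>\<^bsub>S\<^esub> b)"
    if "a \<in> H'" "b \<in> H'" for i j a b
    using S.class_twist_eq[OF tight H' that] by (simp add: mult_T k_def)
  note iffs = M.group_restrict_op_iff[OF H] S.group_restrict_op_iff[OF H']
    T.group_restrict_op_iff[OF H_class_Times[OF H H']]
  have car: "i \<in> carrier M" if "i \<in> H" for i using M.H_class_carrier[OF H] that by blast
  show ?thesis
    unfolding iffs k_def[symmetric]
  proof
    assume "\<exists>x\<in>H \<times> H'. x \<otimes>\<^bsub>T\<^esub> x = x"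
    then obtain e f where ef: "e \<in> H" "f \<in> H'" "e \<otimes>\<^bsub>M\<^esub> e \<otimes>\<^bsub>M\<^esub> k = e" "f \<otimes>\<^bsub>S\<^esub> f = f"
      using mult by auto
    note ec = car[OF ef(1)]
    \<comment> \<open>In this form \<open>e\<close> itself is the cofactor leading from
      \<open>e \<otimes> k\<close> back to \<open>e\<close>.\<close>
    have "e = e \<otimes>\<^bsub>M\<^esub> k \<otimes>\<^bsub>M\<^esub> e" using ef(3) ec k by (simp add: M.m_ac)
    then have "e \<otimes>\<^bsub>M\<^esub> k \<in> H" by (rule M.H_class_mult_mem[OF H ef(1) k ec])
    \<comment> \<open>Regrouping exposes \<open>e \<otimes> e \<otimes> k = e\<close>, which reduces
      the square of \<open>e \<otimes> k\<close> to \<open>e \<otimes> k\<close>.\<close>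
    moreover have "e \<otimes>\<^bsub>M\<^esub> k \<otimes>\<^bsub>M\<^esub> (e \<otimes>\<^bsub>M\<^esub> k) = e \<otimes>\<^bsub>M\<^esub> e \<otimes>\<^bsub>M\<^esub> k \<otimes>\<^bsub>M\<^esub> k"
      using ec k by (simp add: M.m_ac)
    moreover have "green_le_J M e k"
      using M.green_le_J_iff[OF ec k] ef(3) ec by (metis M.m_closed)
    ultimately show "(\<exists>e\<in>H. e \<otimes>\<^bsub>M\<^esub> e = e) \<and> (\<exists>e\<in>H'. e \<otimes>\<^bsub>S\<^esub> e = e) \<and>
        (\<exists>i\<in>H. green_le_J M i k)"
      using ef by auto
  next
    assume "(\<exists>e\<in>H. e \<otimes>\<^bsub>M\<^esub> e = e) \<and> (\<exists>e\<in>H'. e \<otimes>\<^bsub>S\<^esub> e = e) \<and>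
        (\<exists>i\<in>H. green_le_J M i k)"
    then obtain e f where ef: "e \<in> H" "e \<otimes>\<^bsub>M\<^esub> e = e" "f \<in> H'" "f \<otimes>\<^bsub>S\<^esub> f = f"
      and "\<forall>i\<in>H. green_le_J M i k"
      using M.H_class_ex_J_iff_all[OF H] by blast
    note ec = car[OF ef(1)]
    then obtain l where l: "l \<in> carrier M" "e = l \<otimes>\<^bsub>M\<^esub> k"
      using \<open>\<forall>i\<in>H. green_le_J M i k\<close> ef(1) M.green_le_J_iff[OF ec k] by blast
    \<comment> \<open>The element \<open>l\<close> need not lie in \<open>H\<close>, but
      \<open>e \<otimes> l\<close> does, since multiplying it by \<open>k\<close> returns
      \<open>e\<close>.\<close>
    have "e = e \<otimes>\<^bsub>M\<^esub> l \<otimes>\<^bsub>M\<^esub> k" using ef(2) l ec k by (simp add: M.m_assoc)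
    then have el: "e \<otimes>\<^bsub>M\<^esub> l \<in> H" by (rule M.H_class_mult_mem[OF H ef(1) l(1) k])
    have "e \<otimes>\<^bsub>M\<^esub> l \<otimes>\<^bsub>M\<^esub> (e \<otimes>\<^bsub>M\<^esub> l) \<otimes>\<^bsub>M\<^esub> k = e \<otimes>\<^bsub>M\<^esub> e \<otimes>\<^bsub>M\<^esub> (l \<otimes>\<^bsub>M\<^esub> k) \<otimes>\<^bsub>M\<^esub> l"
      using ec l(1) k by (simp add: M.m_ac)
    also have "\<dots> = e \<otimes>\<^bsub>M\<^esub> l" using ef(2) l(2) by simp
    finally show "\<exists>x\<in>H \<times> H'. x \<otimes>\<^bsub>T\<^esub> x = x"
      using el ef(3,4) mult by (intro bexI[of _ "(e \<otimes>\<^bsub>M\<^esub> l, f)"]) auto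
  qed
qed

text \<open>A product in \<open>T\<close> carries one factor \<open>k\<close> and the map adds
  another; these two supply one \<open>k\<close> to each factor of the image product.\<close>

lemma Times_iso:
  assumes H: "H \<in> H_classes M" and H': "H' \<in> H_classes S"
    and grp: "group (restrict_op T (H \<times> H'))"
  shows "restrict_op T (H \<times> H') \<cong> restrict_op M H \<times>\<times> restrict_op S H'"
proof -
  define k where "k = q [^]\<^bsub>M\<^esub> class_twist \<Phi> H'"
  have k: "k \<in> carrier M" using q by (simp add: k_def)
  have car: "i \<in> carrier M" if "i \<in> H" for i using M.H_class_carrier[OF H] that by blast
  obtain e where e: "e \<in> H" "e \<otimes>\<^bsub>M\<^esub> e = e" and le: "\<exists>i\<in>H. green_le_J M i k"
    using grp group_Times_iff[OF H H'] M.group_restrict_op_iff[OF H] k_def by auto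
  have Hk: "H = H #>\<^bsub>M\<^esub> k" using M.H_class_idem_eq_translate_iff[OF H e k] le by blast
  obtain l where l: "l \<in> carrier M" "e = l \<otimes>\<^bsub>M\<^esub> k"
    using le e(1) M.H_class_ex_J_iff_all[OF H] M.green_le_J_iff[OF car[OF e(1)] k] by blast
  \<comment> \<open>Multiplication by \<open>l\<close> undoes the map, which gives injectivity;
    surjectivity is \<open>Hk\<close>.\<close>
  have ret: "i \<otimes>\<^bsub>M\<^esub> k \<otimes>\<^bsub>M\<^esub> l = i" if "i \<in> H" for i
    using M.H_class_group_identity[OF H e that] l k car[OF that] by (simp add: M.m_ac)
  let ?f = "\<lambda>(i, a). (i \<otimes>\<^bsub>M\<^esub> k, a)"
  have "inj_on ?f (H \<times> H')"
    using ret by (auto intro!: inj_onI) metis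
  moreover have img: "?f ` (H \<times> H') = H \<times> H'"
  proof -
    have "(\<lambda>i. i \<otimes>\<^bsub>M\<^esub> k) ` H = H" using Hk by (auto simp: r_coset_def)
    moreover have "?f ` (H \<times> H') = ((\<lambda>i. i \<otimes>\<^bsub>M\<^esub> k) ` H) \<times> H'" by force
    ultimately show ?thesis by simp
  qed
  ultimately have bij: "bij_betw ?f (H \<times> H') (H \<times> H')" by (simp add: bij_betw_def)
  have "?f \<in> hom (restrict_op T (H \<times> H')) (restrict_op M H \<times>\<times> restrict_op S H')"
  proof (rule homI)
    fix x assume "x \<in> carrier (restrict_op T (H \<times> H'))"
    then show "?f x \<in> carrier (restrict_op M H \<times>\<times> restrict_op S H')"
      unfolding restrict_op_def DirProd_def partial_object.simps using img by blast
  next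
    fix x y
    assume "x \<in> carrier (restrict_op T (H \<times> H'))" "y \<in> carrier (restrict_op T (H \<times> H'))"
    then obtain i a j b where xy: "x = (i, a)" "y = (j, b)" "i \<in> H" "j \<in> H" "a \<in> H'" "b \<in> H'"
      by (auto simp: restrict_op_def)
    have "i \<otimes>\<^bsub>M\<^esub> j \<otimes>\<^bsub>M\<^esub> k \<otimes>\<^bsub>M\<^esub> k = i \<otimes>\<^bsub>M\<^esub> k \<otimes>\<^bsub>M\<^esub> (j \<otimes>\<^bsub>M\<^esub> k)"
      using car xy k by (simp add: M.m_ac)
    then show "?f (x \<otimes>\<^bsub>restrict_op T (H \<times> H')\<^esub> y) =
        ?f x \<otimes>\<^bsub>restrict_op M H \<times>\<times> restrict_op S H'\<^esub> ?f y"
      using xy S.class_twist_eq[OF tight H' xy(5,6)]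
      by (simp add: restrict_op_def mult_T k_def)
  qed
  with bij have "?f \<in> iso (restrict_op T (H \<times> H')) (restrict_op M H \<times>\<times> restrict_op S H')"
    by (simp add: iso_def restrict_op_def DirProd_def)
  then show ?thesis by (rule is_isoI)
qed

end

theorem theorem6p2:
  fixes M :: "('a, 'x) monoid_scheme" and S :: "('b, 'y) monoid_scheme"
    and q :: 'a and \<Phi> :: "'b \<Rightarrow> 'b \<Rightarrow> nat"
    and T :: "('a \<times> 'b) monoid"
    and H :: "'a set" and H' :: "'b set"
  assumes "comm_monoid M" and "monoid S" and "q \<in> carrier M"
    and "tight_twisting S \<Phi>"
    and "T = twisted_product M q S \<Phi>"
    and "H \<in> H_classes M" and "H' \<in> H_classes S"
  shows
    "((H \<times> H' \<in> H_classes T \<and> group (restrict_op T (H \<times> H'))) \<longleftrightarrow>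
        group (restrict_op M H) \<and> group (restrict_op S H') \<and>
        H = H #>\<^bsub>M\<^esub> (q [^]\<^bsub>M\<^esub> class_twist \<Phi> H')) \<and>
     ((H \<times> H' \<in> H_classes T \<and> group (restrict_op T (H \<times> H'))) \<longleftrightarrow>
        group (restrict_op M H) \<and> group (restrict_op S H') \<and>
        (\<exists>i\<in>H. green_le_J M i (q [^]\<^bsub>M\<^esub> class_twist \<Phi> H'))) \<and>
     ((\<exists>i\<in>H. green_le_J M i (q [^]\<^bsub>M\<^esub> class_twist \<Phi> H')) \<longleftrightarrow>
        (\<forall>i\<in>H. green_le_J M i (q [^]\<^bsub>M\<^esub> class_twist \<Phi> H'))) \<and>
     ((H \<times> H' \<in> H_classes T \<and> group (restrict_op T (H \<times> H'))) \<longleftrightarrow>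
        group (restrict_op M H) \<and> group (restrict_op S H') \<and>
        (class_twist \<Phi> H' = 0 \<or> (\<exists>i\<in>H. green_le_J M i q))) \<and>
     ((\<exists>i\<in>H. green_le_J M i q) \<longleftrightarrow> (\<forall>i\<in>H. green_le_J M i q)) \<and>
     (H \<times> H' \<in> H_classes T \<and> group (restrict_op T (H \<times> H')) \<longrightarrow>
        restrict_op T (H \<times> H') \<cong> restrict_op M H \<times>\<times> restrict_op S H')"
proof -
  interpret tight_product M S q \<Phi>
    using assms(1-4) by (simp add: tight_product_def tight_product_axioms_def)
  note T = assms(5) and H = assms(6) and H' = assms(7)
  let ?n = "class_twist \<Phi> H'"
  have grp: "H \<times> H' \<in> H_classes T \<and> group (restrict_op T (H \<times> H')) \<longleftrightarrow>
      group (restrict_op M H) \<and> group (restrict_op S H') \<and>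
      (\<exists>i\<in>H. green_le_J M i (q [^]\<^bsub>M\<^esub> ?n))"
    unfolding T using group_Times_iff[OF H H'] H_class_Times[OF H H'] by blast
  \<comment> \<open>Conditions (ii) and (iv) differ from (iii) only in their last clause. These
    clauses agree once \<open>H\<close> contains an idempotent, which exists when \<open>H\<close>
    is a group.\<close>
  have "H = H #>\<^bsub>M\<^esub> (q [^]\<^bsub>M\<^esub> ?n) \<longleftrightarrow> (\<exists>i\<in>H. green_le_J M i (q [^]\<^bsub>M\<^esub> ?n))"
    and "(\<exists>i\<in>H. green_le_J M i (q [^]\<^bsub>M\<^esub> ?n)) \<longleftrightarrow> ?n = 0 \<or> (\<exists>i\<in>H. green_le_J M i q)"
    if "group (restrict_op M H)"
    using that M.group_restrict_op_iff[OF H] q M.H_class_idem_eq_translate_iff[OF H]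
      M.H_class_idem_le_pow_iff[OF H] by (meson M.nat_pow_closed)+
  moreover note M.H_class_ex_J_iff_all[OF H]
  moreover have "H \<times> H' \<in> H_classes T \<and> group (restrict_op T (H \<times> H')) \<longrightarrow>
      restrict_op T (H \<times> H') \<cong> restrict_op M H \<times>\<times> restrict_op S H'"
    unfolding T using Times_iso[OF H H'] by blast
  ultimately show ?thesis using grp by (intro conjI) blast+
qed

end
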